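(* Let $t$ be a $\lambda$-term. If $t$ is strongly normalizing for the $\beta$-reduction, then $t$ is strongly normalizing for the reduction generated by the union of the four rules $\beta$, $\delta$, $\gamma$ and $assoc$.
   Context: $\lambda$-terms are given by the grammar $\mathcal M ::= x \mid \lambda x.\mathcal M \mid (\mathcal M\ \mathcal M)$; application associates to the left, so $(M\ N\ P)$ means $((M\ N)\ P)$, and $(\lambda x.M\ N)$ denotes the application of the abstraction $\lambda x.M$ to $N$. Terms are taken up to renaming of bound variables (Barendregt's convention). The reduction rules, applicable to any subterm, are: $\beta$: $(\lambda x.M\ N) \triangleright M[x:=N]$ (capture-avoiding substitution); $\delta$: $(\lambda y.\lambda x.M\ N) \triangleright \lambda x.(\lambda y.M\ N)$, where $x$ is not free in $N$; $\gamma$: $(\lambda x.M\ N\ P) \triangleright (\lambda x.(M\ P)\ N)$, where $x$ is not free in $P$; $assoc$: $(M\ (\lambda x.N\ P)) \triangleright (\lambda x.(M\ N)\ P)$, where $x$ is not free in $M$. A term is strongly normalizing for a given reduction if every reduction sequence starting from it is finite. *)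

theory Defs
  imports Main
begin

text \<open>
  Lambda-terms up to renaming of bound variables, in de Bruijn notation: in
  \<open>Lam M\<close>, the index 0 of \<open>M\<close> refers to the variable bound by this abstraction, and the
  index \<open>Suc i\<close> to the variable with index \<open>i\<close> outside the abstraction.
\<close>

datatype lterm = Var nat | App lterm lterm | Lam lterm

primrec rename :: "(nat \<Rightarrow> nat) \<Rightarrow> lterm \<Rightarrow> lterm" where
  "rename f (Var i) = Var (f i)"
| "rename f (App M N) = App (rename f M) (rename f N)"
| "rename f (Lam M) = Lam (rename (case_nat 0 (Suc \<circ> f)) M)"

primrec subst :: "(nat \<Rightarrow> lterm) \<Rightarrow> lterm \<Rightarrow> lterm" where
  "subst \<sigma> (Var i) = \<sigma> i"
| "subst \<sigma> (App M N) = App (subst \<sigma> M) (subst \<sigma> N)"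
| "subst \<sigma> (Lam M) = Lam (subst (case_nat (Var 0) (rename Suc \<circ> \<sigma>)) M)"

text \<open>
  A term that is moved below an additional binder \<open>x\<close> becomes \<open>rename Suc N\<close>. Index 0 does
  not occur free in \<open>rename Suc N\<close>, which is the side condition that \<open>x\<close> is not free in
  \<open>N\<close>; up to renaming of \<open>x\<close> this condition can always be met, so that no premise remains.
\<close>

inductive beta_rule :: "lterm \<Rightarrow> lterm \<Rightarrow> bool" where
  "beta_rule (App (Lam M) N) (subst (case_nat N Var) M)"

text \<open>
  In the left-hand side of the \<open>\<delta>\<close> rule, the indices 0 and 1 of \<open>M\<close> stand for \<open>x\<close> and \<open>y\<close>;
  in the right-hand side the two binders have changed places.
\<close>

inductive delta_rule :: "lterm \<Rightarrow> lterm \<Rightarrow> bool" where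
  "delta_rule (App (Lam (Lam M)) N)
     (Lam (App (Lam (rename (id(0 := 1, 1 := 0)) M)) (rename Suc N)))"

inductive gamma_rule :: "lterm \<Rightarrow> lterm \<Rightarrow> bool" where
  "gamma_rule (App (App (Lam M) N) P) (App (Lam (App M (rename Suc P))) N)"

inductive assoc_rule :: "lterm \<Rightarrow> lterm \<Rightarrow> bool" where
  "assoc_rule (App M (App (Lam N) P)) (App (Lam (App (rename Suc M) N)) P)"

inductive reduces :: "(lterm \<Rightarrow> lterm \<Rightarrow> bool) \<Rightarrow> lterm \<Rightarrow> lterm \<Rightarrow> bool"
  for R :: "lterm \<Rightarrow> lterm \<Rightarrow> bool" where
  root: "R M N \<Longrightarrow> reduces R M N"
| lam: "reduces R M N \<Longrightarrow> reduces R (Lam M) (Lam N)"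
| appL: "reduces R M N \<Longrightarrow> reduces R (App M P) (App N P)"
| appR: "reduces R M N \<Longrightarrow> reduces R (App P M) (App P N)"

definition strongly_normalizing :: "(lterm \<Rightarrow> lterm \<Rightarrow> bool) \<Rightarrow> lterm \<Rightarrow> bool" where
  "strongly_normalizing R t \<longleftrightarrow>
     \<not> (\<exists>s :: nat \<Rightarrow> lterm. s 0 = t \<and> (\<forall>i. reduces R (s i) (s (Suc i))))"

end

theory Submission
  imports Defs
begin

text \<open>
  Write \<open>\<parallel>t\<parallel>\<close> for the weight that follows weak head reduction and charges every argument:
  \<open>\<parallel>Lam M\<parallel> = \<parallel>M\<parallel>\<close>, \<open>\<parallel>x P\<^sub>1 \<dots> P\<^sub>n\<parallel> = \<Sum>\<^sub>i \<parallel>P\<^sub>i\<parallel>\<close>, and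
  \<open>\<parallel>(Lam M) N P\<^sub>1 \<dots> P\<^sub>n\<parallel> = \<parallel>M[N] P\<^sub>1 \<dots> P\<^sub>n\<parallel> + \<parallel>N\<parallel> + 1\<close>.
  It is finite on terms that are strongly normalizing for \<open>\<beta>\<close>. As \<open>\<parallel>N\<parallel>\<close> is charged even if
  \<open>N\<close> is erased, every \<open>\<beta>\<close>-step, at any position, strictly decreases the weight, and no
  \<open>\<delta>\<close>-, \<open>\<gamma>\<close>- or \<open>assoc\<close>-step increases it. The latter three rules terminate on their own by
  a polynomial interpretation, so the lexicographic combination of the two measures decreases
  in each step.
\<close>

section \<open>Composition laws for renaming and substitution\<close>

lemma rename_rename: "rename f (rename g M) = rename (f \<circ> g) M"
proof (induction M arbitrary: f g)
  case (Lam M)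
  have "case_nat 0 (Suc \<circ> f) \<circ> case_nat 0 (Suc \<circ> g) = case_nat 0 (Suc \<circ> (f \<circ> g))"
    by (rule ext) (simp split: nat.split)
  then show ?case by (simp only: rename.simps subst.simps Lam.IH)
qed simp_all

lemma subst_rename: "subst \<sigma> (rename f M) = subst (\<sigma> \<circ> f) M"
proof (induction M arbitrary: \<sigma> f)
  case (Lam M)
  have "case_nat (Var 0) (rename Suc \<circ> \<sigma>) \<circ> case_nat 0 (Suc \<circ> f)
      = case_nat (Var 0) (rename Suc \<circ> (\<sigma> \<circ> f))"
    by (rule ext) (simp split: nat.split)
  then show ?case by (simp only: rename.simps subst.simps Lam.IH)
qed simp_all

lemma rename_subst: "rename f (subst \<sigma> M) = subst (rename f \<circ> \<sigma>) M"
proof (induction M arbitrary: \<sigma> f)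
  case (Lam M)
  have "rename (case_nat 0 (Suc \<circ> f)) \<circ> case_nat (Var 0) (rename Suc \<circ> \<sigma>)
      = case_nat (Var 0) (rename Suc \<circ> (rename f \<circ> \<sigma>))"
    by (rule ext) (simp add: rename_rename o_def split: nat.split)
  then show ?case by (simp only: rename.simps subst.simps Lam.IH)
qed simp_all

lemma subst_subst: "subst \<sigma> (subst \<tau> M) = subst (subst \<sigma> \<circ> \<tau>) M"
proof (induction M arbitrary: \<sigma> \<tau>)
  case (Lam M)
  have "subst (case_nat (Var 0) (rename Suc \<circ> \<sigma>)) \<circ> case_nat (Var 0) (rename Suc \<circ> \<tau>)
      = case_nat (Var 0) (rename Suc \<circ> (subst \<sigma> \<circ> \<tau>))"
    by (rule ext) (simp add: subst_rename rename_subst o_def split: nat.split)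
  then show ?case by (simp only: rename.simps subst.simps Lam.IH)
qed simp_all

lemma subst_Var: "subst Var M = M"
proof (induction M)
  case (Lam M)
  have "case_nat (Var 0) (rename Suc \<circ> Var) = Var"
    by (rule ext) (simp split: nat.split)
  then show ?case by (simp only: rename.simps subst.simps Lam.IH)
qed simp_all

lemma rename_conv_subst: "rename f M = subst (Var \<circ> f) M"
proof -
  have "rename f \<circ> Var = Var \<circ> f" by (rule ext) simp
  then show ?thesis using rename_subst[of f Var M] by (simp only: subst_Var)
qed

abbreviation inst :: "lterm \<Rightarrow> lterm \<Rightarrow> lterm" where
  "inst M N \<equiv> subst (case_nat N Var) M"

abbreviation lift :: "(nat \<Rightarrow> lterm) \<Rightarrow> nat \<Rightarrow> lterm" where
  "lift \<sigma> \<equiv> case_nat (Var 0) (rename Suc \<circ> \<sigma>)"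

lemma inst_rename_Suc [simp]: "inst (rename Suc M) N = M"
proof -
  have "case_nat N Var \<circ> Suc = Var" by (rule ext) simp
  then show ?thesis by (simp add: subst_rename subst_Var)
qed

lemma subst_inst: "subst \<sigma> (inst M N) = inst (subst (lift \<sigma>) M) (subst \<sigma> N)"
proof -
  have "subst \<sigma> \<circ> case_nat N Var = subst (case_nat (subst \<sigma> N) Var) \<circ> lift \<sigma>"
    by (rule ext) (simp split: nat.split)
  then show ?thesis by (simp only: subst_subst)
qed

lemma subst_lift_rename_Suc: "subst (lift \<sigma>) (rename Suc M) = rename Suc (subst \<sigma> M)"
proof -
  have "lift \<sigma> \<circ> Suc = rename Suc \<circ> \<sigma>" by (rule ext) simp
  then show ?thesis by (simp add: subst_rename rename_subst)
qed

abbreviation swap :: "nat \<Rightarrow> nat" where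
  "swap \<equiv> id(0 := 1, 1 := 0)"

text \<open>A substitution lifted twice fixes the indices 0 and 1, and neither of them occurs in its
  other values.\<close>

lemma subst_lift_lift_swap:
  "subst (lift (lift \<sigma>)) (rename swap M) = rename swap (subst (lift (lift \<sigma>)) M)"
proof -
  have "lift (lift \<sigma>) \<circ> swap = rename swap \<circ> lift (lift \<sigma>)"
  proof
    fix i
    consider "i = 0" | "i = 1" | j where "i = Suc (Suc j)"
      by (metis One_nat_def nat.exhaust)
    moreover have "swap \<circ> (Suc \<circ> Suc) = Suc \<circ> Suc" by (rule ext) simp
    ultimately show "(lift (lift \<sigma>) \<circ> swap) i = (rename swap \<circ> lift (lift \<sigma>)) i"
      by cases (simp_all add: rename_rename)
  qed
  then show ?thesis by (simp only: subst_rename rename_subst)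
qed

text \<open>Contracting the redex that \<open>delta_rule\<close> leaves below the outer abstraction
  yields the body of the abstraction obtained by contracting the original redex.\<close>

lemma inst_swap: "inst (rename swap M) (rename Suc N) = subst (lift (case_nat N Var)) M"
proof -
  have "case_nat (rename Suc N) Var \<circ> swap = lift (case_nat N Var)"
  proof
    fix i
    consider "i = 0" | "i = 1" | j where "i = Suc (Suc j)"
      by (metis One_nat_def nat.exhaust)
    then show "(case_nat (rename Suc N) Var \<circ> swap) i = lift (case_nat N Var) i"
      by cases simp_all
  qed
  then show ?thesis by (simp only: subst_rename)
qed

section \<open>Compatibility of reduction with substitution\<close>

text \<open>The three rules are grouped because none of them increases the weight and one polynomial
  measure decreases under all of them.\<close>

definition perm_rule :: "lterm \<Rightarrow> lterm \<Rightarrow> bool" where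
  "perm_rule M N \<longleftrightarrow> delta_rule M N \<or> gamma_rule M N \<or> assoc_rule M N"

lemma beta_rule_subst: "beta_rule M N \<Longrightarrow> beta_rule (subst \<sigma> M) (subst \<sigma> N)"
  by (auto elim!: beta_rule.cases simp: subst_inst intro: beta_rule.intros)

lemma perm_rule_subst:
  assumes "perm_rule M N"
  shows "perm_rule (subst \<sigma> M) (subst \<sigma> N)"
proof -
  consider "delta_rule M N" | "gamma_rule M N" | "assoc_rule M N"
    using assms unfolding perm_rule_def by blast
  then show ?thesis
  proof cases
    case 1
    then show ?thesis
    proof cases
      case (1 A B)
      have "delta_rule (App (Lam (Lam (subst (lift (lift \<sigma>)) A))) (subst \<sigma> B))
        (Lam (App (Lam (rename swap (subst (lift (lift \<sigma>)) A))) (rename Suc (subst \<sigma> B))))"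
        by (rule delta_rule.intros)
      then show ?thesis
        unfolding perm_rule_def 1 subst.simps subst_lift_lift_swap subst_lift_rename_Suc by blast
    qed
  next
    case 2
    then show ?thesis
      by cases (simp add: perm_rule_def subst_lift_rename_Suc gamma_rule.intros)
  next
    case 3
    then show ?thesis
      by cases (simp add: perm_rule_def subst_lift_rename_Suc assoc_rule.intros)
  qed
qed

lemma reduces_subst:
  assumes "reduces R M N" and "\<And>M N \<sigma>. R M N \<Longrightarrow> R (subst \<sigma> M) (subst \<sigma> N)"
  shows "reduces R (subst \<sigma> M) (subst \<sigma> N)"
  using assms(1) by (induction arbitrary: \<sigma>) (auto intro: reduces.intros assms(2))

lemma beta_subst:
  "reduces beta_rule M N \<Longrightarrow> reduces beta_rule (subst \<sigma> M) (subst \<sigma> N)"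
  by (erule reduces_subst) (rule beta_rule_subst)

lemma perm_subst:
  "reduces perm_rule M N \<Longrightarrow> reduces perm_rule (subst \<sigma> M) (subst \<sigma> N)"
  by (erule reduces_subst) (rule perm_rule_subst)

lemma rtranclp_reduces_lam: "(reduces R)\<^sup>*\<^sup>* M N \<Longrightarrow> (reduces R)\<^sup>*\<^sup>* (Lam M) (Lam N)"
  by (induction rule: rtranclp_induct) (auto intro: reduces.lam rtranclp.rtrancl_into_rtrancl)

lemma rtranclp_reduces_appL: "(reduces R)\<^sup>*\<^sup>* M N \<Longrightarrow> (reduces R)\<^sup>*\<^sup>* (App M P) (App N P)"
  by (induction rule: rtranclp_induct) (auto intro: reduces.appL rtranclp.rtrancl_into_rtrancl)

lemma rtranclp_reduces_appR: "(reduces R)\<^sup>*\<^sup>* M N \<Longrightarrow> (reduces R)\<^sup>*\<^sup>* (App P M) (App P N)"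
  by (induction rule: rtranclp_induct) (auto intro: reduces.appR rtranclp.rtrancl_into_rtrancl)

text \<open>A variable may occur any number of times, so one step in a substituted term becomes zero
  or more steps.\<close>

lemma rtranclp_reduces_subst:
  assumes "\<And>i. (reduces R)\<^sup>*\<^sup>* (\<sigma> i) (\<tau> i)"
    and "\<And>M N \<sigma>. R M N \<Longrightarrow> R (subst \<sigma> M) (subst \<sigma> N)"
  shows "(reduces R)\<^sup>*\<^sup>* (subst \<sigma> M) (subst \<tau> M)"
  using assms(1)
proof (induction M arbitrary: \<sigma> \<tau>)
  case (App M1 M2)
  then show ?case
    by (simp) (meson rtranclp_reduces_appL rtranclp_reduces_appR rtranclp_trans)
next
  case (Lam M)
  have ren: "(reduces R)\<^sup>*\<^sup>* (rename Suc A) (rename Suc B)" if "(reduces R)\<^sup>*\<^sup>* A B" for A B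
    using that
    by (induction rule: rtranclp_induct)
      (auto simp: rename_conv_subst intro: reduces_subst assms(2) rtranclp.rtrancl_into_rtrancl)
  have "(reduces R)\<^sup>*\<^sup>* (lift \<sigma> i) (lift \<tau> i)" for i
    using ren Lam.prems by (simp split: nat.split)
  from rtranclp_reduces_lam[OF Lam.IH[OF this]] show ?case by simp
qed simp

lemma rtranclp_reduces_inst:
  assumes "reduces R N N'" and "\<And>M N \<sigma>. R M N \<Longrightarrow> R (subst \<sigma> M) (subst \<sigma> N)"
  shows "(reduces R)\<^sup>*\<^sup>* (inst M N) (inst M N')"
  by (rule rtranclp_reduces_subst) (use assms in \<open>auto split: nat.split\<close>)

lemma beta_inst:
  "reduces beta_rule N N' \<Longrightarrow> (reduces beta_rule)\<^sup>*\<^sup>* (inst M N) (inst M N')"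
  by (erule rtranclp_reduces_inst) (rule beta_rule_subst)

lemma perm_inst:
  "reduces perm_rule N N' \<Longrightarrow> (reduces perm_rule)\<^sup>*\<^sup>* (inst M N) (inst M N')"
  by (erule rtranclp_reduces_inst) (rule perm_rule_subst)

section \<open>Weak head reduction\<close>

inductive neutral :: "lterm \<Rightarrow> bool" where
  "neutral (Var i)"
| "neutral t \<Longrightarrow> neutral (App t P)"

text \<open>The third argument records the argument of the contracted head redex.\<close>

inductive hstep :: "lterm \<Rightarrow> lterm \<Rightarrow> lterm \<Rightarrow> bool" where
  hd: "hstep (App (Lam M) N) (inst M N) N"
| arg: "hstep t s N \<Longrightarrow> hstep (App t P) (App s P) N"

inductive_cases neutral_LamE [elim!]: "neutral (Lam M)"
inductive_cases neutral_AppE [elim!]: "neutral (App M N)"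
inductive_cases hstep_VarE [elim!]: "hstep (Var i) s N"
inductive_cases hstep_LamE [elim!]: "hstep (Lam M) s N"
inductive_cases hstep_AppE: "hstep (App t P) s N"
inductive_cases beta_ruleE: "beta_rule (App M N) t"

lemma neutral_no_hstep: "neutral t \<Longrightarrow> \<not> hstep t s N"
  by (induction arbitrary: s rule: neutral.induct) (auto elim: hstep_AppE)

lemma hstep_deterministic: "hstep t s N \<Longrightarrow> hstep t s' N' \<Longrightarrow> s' = s \<and> N' = N"
  by (induction arbitrary: s' rule: hstep.induct) (auto elim: hstep_AppE)

text \<open>The three shapes match the three clauses of the weight.\<close>

lemma head_cases:
  obtains M where "t = Lam M" | "neutral t" | s N where "hstep t s N"
  by (induction t) (auto intro: neutral.intros hstep.intros)

lemma hstep_beta: "hstep t s N \<Longrightarrow> reduces beta_rule t s"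
  by (induction rule: hstep.induct) (auto intro: reduces.intros beta_rule.intros)

lemma hstep_subst: "hstep t s N \<Longrightarrow> hstep (subst \<sigma> t) (subst \<sigma> s) (subst \<sigma> N)"
  by (induction rule: hstep.induct) (auto simp: subst_inst intro: hstep.intros)

lemma hstep_rename: "hstep t s N \<Longrightarrow> hstep (rename f t) (rename f s) (rename f N)"
  by (simp add: rename_conv_subst hstep_subst)

text \<open>Contracting the redex created by \<open>assoc\<close> leaves \<open>t\<close> untouched,
  as index 0 does not occur in \<open>rename Suc t\<close>; the result is the original term with its
  argument contracted.\<close>

lemma hstep_assoc: "hstep (App (Lam (App (rename Suc t) A)) B) (App t (inst A B)) B"
  using hstep.hd[of "App (rename Suc t) A" B] by (simp only: subst.simps(2) inst_rename_Suc)

lemma hstep_gamma: "hstep (App (Lam (App M (rename Suc P))) N) (App (inst M N) P) N"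
  using hstep.hd[of "App M (rename Suc P)" N] by (simp only: subst.simps(2) inst_rename_Suc)

lemma neutral_rename: "neutral t \<Longrightarrow> neutral (rename f t)"
  by (induction rule: neutral.induct) (auto intro: neutral.intros)

section \<open>The weight, given by its upper bounds\<close>

text \<open>\<open>bounded t n\<close> says that the weight of \<open>t\<close> is defined and at most \<open>n\<close>.\<close>

inductive bounded :: "lterm \<Rightarrow> nat \<Rightarrow> bool" where
  Var: "bounded (Var i) n"
| Lam: "bounded M n \<Longrightarrow> bounded (Lam M) n"
| App: "neutral t \<Longrightarrow> bounded t n \<Longrightarrow> bounded P m \<Longrightarrow> n + m \<le> k \<Longrightarrow> bounded (App t P) k"
| hstep: "hstep t s N \<Longrightarrow> bounded s n \<Longrightarrow> bounded N m \<Longrightarrow> n + m < k \<Longrightarrow> bounded t k"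

lemma bounded_mono: "bounded t n \<Longrightarrow> n \<le> m \<Longrightarrow> bounded t m"
proof (induction arbitrary: m rule: bounded.induct)
  case (App t n P m k)
  then show ?case by (meson bounded.App le_trans)
next
  case (hstep t s N n m k)
  then show ?case by (meson bounded.hstep less_le_trans)
qed (auto intro: bounded.intros)

lemma bounded_rename: "bounded t n \<Longrightarrow> bounded (rename f t) n"
proof (induction arbitrary: f rule: bounded.induct)
  case (App t n P m k)
  then show ?case by (metis bounded.App neutral_rename rename.simps(2))
next
  case (hstep t s N n m k)
  then show ?case by (meson bounded.hstep hstep_rename)
qed (auto intro: bounded.intros)

lemma bounded_LamD: "bounded (Lam M) n \<Longrightarrow> bounded M n"
  by (erule bounded.cases) auto

text \<open>Head steps are deterministic and neutral terms have none, so only the clause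
  \<open>hstep\<close> applies, with the given \<open>s\<close> and \<open>N\<close>.\<close>

lemma bounded_hstepE:
  assumes "bounded t k" "hstep t s N"
  obtains n m where "bounded s n" "bounded N m" "n + m < k"
  using assms(1)
proof cases
  case (hstep s' N' n m)
  then show ?thesis
    using hstep_deterministic assms(2) that by blast
next
  case App
  then show ?thesis
    using neutral_no_hstep neutral.intros(2) assms(2) by blast
qed (use assms(2) in auto)

section \<open>Inversion of reduction steps\<close>

inductive_cases reduces_VarE: "reduces R (Var i) t"
inductive_cases reduces_LamE: "reduces R (Lam M) t"

lemma reduces_AppE:
  assumes "reduces R (App M N) t"
  obtains (root) "R (App M N) t"
    | (appL) M' where "t = App M' N" "reduces R M M'"
    | (appR) N' where "t = App M N'" "reduces R N N'"
  using assms by cases (auto intro: that)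

lemma no_rule_Var_Lam [simp]:
  "\<not> beta_rule (Var i) t" "\<not> perm_rule (Var i) t"
  "\<not> beta_rule (Lam M) t" "\<not> perm_rule (Lam M) t"
  by (auto simp: perm_rule_def
      elim: beta_rule.cases delta_rule.cases gamma_rule.cases assoc_rule.cases)

lemma perm_rule_AppE:
  assumes "perm_rule (App t P) t'"
  obtains (delta) M where "t = Lam (Lam M)" "t' = Lam (App (Lam (rename swap M)) (rename Suc P))"
    | (gamma) M N where "t = App (Lam M) N" "t' = App (Lam (App M (rename Suc P))) N"
    | (assoc) A B where "P = App (Lam A) B" "t' = App (Lam (App (rename Suc t) A)) B"
  using assms unfolding perm_rule_def
  by (elim disjE delta_rule.cases gamma_rule.cases assoc_rule.cases) (blast intro: that)+

section \<open>Beta steps decrease the weight\<close>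

text \<open>A step outside the argument of the head redex survives as exactly one step of
  \<open>s\<close>. A step inside this argument may be copied or erased in \<open>s\<close>, but the
  recorded argument still makes one step.\<close>

lemma hstep_beta_diagram:
  assumes "hstep t s N" "reduces beta_rule t t'"
  shows "t' = s \<or> (\<exists>s' N'. hstep t' s' N' \<and>
    (reduces beta_rule s s' \<and> N' = N \<or> (reduces beta_rule)\<^sup>*\<^sup>* s s' \<and> reduces beta_rule N N'))"
  using assms
proof (induction arbitrary: t' rule: hstep.induct)
  case (hd M N)
  from hd show ?case
  proof (cases rule: reduces_AppE)
    case root
    then show ?thesis by (auto elim: beta_ruleE)
  next
    case (appL M')
    from this(2) obtain M'' where "M' = Lam M''" "reduces beta_rule M M''"
      by (auto elim: reduces_LamE)
    with appL show ?thesis by (metis beta_subst hstep.hd)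
  next
    case (appR N')
    then show ?thesis by (metis beta_inst hstep.hd)
  qed
next
  case (arg t s N P)
  have not_Lam: "t \<noteq> Lam M" for M using arg.hyps by auto
  from arg.prems show ?case
  proof (cases rule: reduces_AppE)
    case root
    then show ?thesis using not_Lam by (auto elim: beta_ruleE)
  next
    case (appL t'')
    with arg.IH[OF appL(2)] show ?thesis
      by (metis hstep.arg reduces.appL rtranclp_reduces_appL)
  next
    case (appR P')
    with arg.hyps show ?thesis by (metis hstep.arg reduces.appR)
  qed
qed

lemma neutral_beta: "neutral t \<Longrightarrow> reduces beta_rule t t' \<Longrightarrow> neutral t'"
proof (induction arbitrary: t' rule: neutral.induct)
  case (1 i)
  then show ?case by (auto elim: reduces_VarE)
next
  case (2 t P)
  from 2(3) show ?case
    by (cases rule: reduces_AppE) (use 2 in \<open>auto elim: beta_ruleE intro: neutral.intros\<close>)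
qed

text \<open>Preservation is assumed for the given \<open>n\<close> only, so that an induction
  hypothesis restricted to small bounds can supply it.\<close>

lemma bounded_rtranclp:
  assumes "R\<^sup>*\<^sup>* t t'" "bounded t n"
    and "\<And>t t'. bounded t n \<Longrightarrow> R t t' \<Longrightarrow> bounded t' n"
  shows "bounded t' n"
  using assms(1,2) by (induction rule: rtranclp_induct) (auto intro: assms(3))

text \<open>The induction is lexicographic: passing to the head reduct or the contracted argument
  lowers the bound, though the size may grow; passing to an immediate subterm does not raise the
  bound and lowers the size.\<close>

lemma bounded_beta:
  "bounded t k \<Longrightarrow> reduces beta_rule t t' \<Longrightarrow> \<exists>n<k. bounded t' n"
proof (induction "(k, t)" arbitrary: k t t'
    rule: wf_induct_rule[OF wf_lex_prod[OF wf_less_than wf_measure[of size]]])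
  case (1 k t)
  have IH: "\<exists>n<j. bounded u' n"
    if "j < k \<or> j = k \<and> size u < size t" "bounded u j" "reduces beta_rule u u'" for j u u'
    using 1(1)[of j u u'] that by auto
  from 1(2) show ?case
  proof cases
    case (Var i)
    with 1(3) show ?thesis by (auto elim: reduces_VarE)
  next
    case (Lam M)
    with 1(3) obtain M' where M': "t' = Lam M'" "reduces beta_rule M M'"
      by (auto elim: reduces_LamE)
    with IH[of k M M'] Lam show ?thesis by (auto intro: bounded.Lam)
  next
    case (App t0 n P m)
    from 1(3)[unfolded App(1)] show ?thesis
    proof (cases rule: reduces_AppE)
      case root
      then show ?thesis using App(2) by (auto elim: beta_ruleE)
    next
      case (appL t1)
      obtain n' where "n' < n" "bounded t1 n'"
        using IH[of n t0 t1] App appL(2) by force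
      with App appL have "bounded t' (n' + m)" "n' + m < k"
        by (auto intro: bounded.App neutral_beta)
      then show ?thesis by blast
    next
      case (appR P')
      obtain m' where "m' < m" "bounded P' m'"
        using IH[of m P P'] App appR(2) by force
      with App appR have "bounded t' (n + m')" "n + m' < k"
        by (auto intro: bounded.App)
      then show ?thesis by blast
    qed
  next
    case (hstep s N n m)
    \<comment> \<open>For a step in the argument, the head reduct may make no step or many, so it is
      only kept within \<open>n\<close>; the strict decrease then comes from
      \<open>N\<close>.\<close>
    have weak: "bounded s' n" if "(reduces beta_rule)\<^sup>*\<^sup>* s s'" for s'
    proof (rule bounded_rtranclp[OF that])
      show "bounded u' n" if "bounded u n" "reduces beta_rule u u'" for u u'
        using IH[of n u u'] that hstep(4) bounded_mono[of u' _ n] by force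
    qed (rule hstep)
    from hstep_beta_diagram[OF hstep(1) 1(3)]
    consider (head) "t' = s"
      | (body) s' where "hstep t' s' N" "reduces beta_rule s s'"
      | (arg) s' N' where "hstep t' s' N'" "(reduces beta_rule)\<^sup>*\<^sup>* s s'" "reduces beta_rule N N'"
      by blast
    then show ?thesis
    proof cases
      case head
      \<comment> \<open>The unit charged for the contraction, hidden in \<open>n + m < k\<close>,
        pays for the head step itself.\<close>
      with hstep show ?thesis by (intro exI[of _ n]) auto
    next
      case body
      obtain n' where "n' < n" "bounded s' n'" using IH[of n s s'] hstep body by force
      then have "bounded t' (Suc (n' + m))" "Suc (n' + m) < k"
        using hstep body by (auto intro: bounded.hstep)
      then show ?thesis by blast
    next
      case arg
      obtain m' where "m' < m" "bounded N' m'" using IH[of m N N'] hstep arg by force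
      then have "bounded t' (Suc (n + m'))" "Suc (n + m') < k"
        using hstep arg weak by (auto intro: bounded.hstep)
      then show ?thesis by blast
    qed
  qed
qed

lemma bounded_rtranclp_beta: "(reduces beta_rule)\<^sup>*\<^sup>* t t' \<Longrightarrow> bounded t n \<Longrightarrow> bounded t' n"
proof (erule bounded_rtranclp)
  fix t t' assume "bounded t n" "reduces beta_rule t t'"
  then obtain m where "m < n" "bounded t' m" using bounded_beta by blast
  then show "bounded t' n" using bounded_mono by simp
qed

section \<open>Permutation steps do not increase the weight\<close>

text \<open>
  The four alternatives are closed under adding an argument to \<open>t\<close>, \<open>s\<close> and \<open>t'\<close> (the second
  one turns into the third). They arise, in this order, from \<open>\<gamma>\<close> at the head or a step
  inside a subterm, from \<open>\<delta>\<close> at the head, from \<open>assoc\<close> applied to a later argument, and from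
  \<open>assoc\<close> applied to the argument of the head redex.
\<close>

lemma hstep_perm_diagram:
  assumes "hstep t s N" "reduces perm_rule t t'"
  shows "(\<exists>s' N'. hstep t' s' N' \<and> (reduces perm_rule)\<^sup>*\<^sup>* s s' \<and> (reduces perm_rule)\<^sup>*\<^sup>* N N')
    \<or> (\<exists>s0 t0. s = Lam s0 \<and> t' = Lam t0 \<and> hstep t0 s0 (rename Suc N))
    \<or> (\<exists>u v s' B. hstep t' u B \<and> hstep u v N \<and> (reduces perm_rule)\<^sup>*\<^sup>* s s' \<and> hstep s' v B)
    \<or> (\<exists>u v B C. hstep N C B \<and> (reduces beta_rule)\<^sup>*\<^sup>* s v \<and> hstep t' u B \<and> hstep u v C)"
  using assms
proof (induction arbitrary: t' rule: hstep.induct)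
  case (hd M N)
  from hd show ?case
  proof (cases rule: reduces_AppE)
    case root
    then show ?thesis
    proof (cases rule: perm_rule_AppE)
      case (delta M0)
      have "hstep (App (Lam (rename swap M0)) (rename Suc N))
          (subst (lift (case_nat N Var)) M0) (rename Suc N)"
        using hstep.hd[of "rename swap M0" "rename Suc N"] by (simp only: inst_swap)
      moreover have "inst M N = Lam (subst (lift (case_nat N Var)) M0)"
        using delta(1) by simp
      ultimately show ?thesis using delta(2) by blast
    next
      case (assoc A B)
      have "hstep t' (App (Lam M) (inst A B)) B" unfolding assoc by (rule hstep_assoc)
      moreover have "hstep (App (Lam M) (inst A B)) (inst M (inst A B)) (inst A B)"
        by (rule hstep.hd)
      moreover have "hstep N (inst A B) B" unfolding assoc by (rule hstep.hd)
      \<comment> \<open>\<open>N\<close> may occur any number of times in \<open>inst M N\<close>,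
        hence zero or more beta steps lead to \<open>inst M (inst A B)\<close>.\<close>
      ultimately show ?thesis using beta_inst[OF hstep_beta] by meson
    qed simp
  next
    case (appL M')
    from this(2) obtain M'' where "M' = Lam M''" "reduces perm_rule M M''"
      by (auto elim: reduces_LamE)
    with appL show ?thesis by (metis perm_subst hstep.hd r_into_rtranclp rtranclp.rtrancl_refl)
  next
    case (appR N')
    then show ?thesis by (metis perm_inst hstep.hd r_into_rtranclp)
  qed
next
  case (arg t s N P)
  from arg.prems show ?case
  proof (cases rule: reduces_AppE)
    case root
    then show ?thesis
    proof (cases rule: perm_rule_AppE)
      case (delta M)
      then show ?thesis using arg.hyps by auto
    next
      case (gamma M N')
      from arg.hyps have "s = inst M N'" "N = N'"
        unfolding gamma by (auto elim: hstep_AppE)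
      \<comment> \<open>Both head reducts coincide: \<open>gamma\<close> only moves \<open>P\<close>
        into the body of the redex.\<close>
      moreover have "hstep t' (App (inst M N') P) N'" unfolding gamma by (rule hstep_gamma)
      ultimately show ?thesis by blast
    next
      case (assoc A B)
      \<comment> \<open>The same \<open>assoc\<close> step on \<open>App s P\<close> supplies
        \<open>s'\<close>; the contractions with arguments \<open>N\<close> and \<open>B\<close>
        occur in opposite orders on the two sides.\<close>
      have "reduces perm_rule (App s P) (App (Lam (App (rename Suc s) A)) B)"
        unfolding assoc by (rule reduces.root) (simp add: perm_rule_def assoc_rule.intros)
      then show ?thesis
        using hstep_assoc hstep.arg[OF arg.hyps] unfolding assoc(2) by blast
    qed
  next
    case (appL t'')
    from arg.IH[OF appL(2)]
    consider (same) s' N' where "hstep t'' s' N'" "(reduces perm_rule)\<^sup>*\<^sup>* s s'"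
        "(reduces perm_rule)\<^sup>*\<^sup>* N N'"
      | (delta) s0 t0 where "s = Lam s0" "t'' = Lam t0" "hstep t0 s0 (rename Suc N)"
      | (commute) u v s' B where "hstep t'' u B" "hstep u v N" "(reduces perm_rule)\<^sup>*\<^sup>* s s'"
        "hstep s' v B"
      | (inner) u v B C where "hstep N C B" "(reduces beta_rule)\<^sup>*\<^sup>* s v" "hstep t'' u B" "hstep u v C"
      by blast
    then show ?thesis
    proof cases
      case same
      then show ?thesis unfolding appL by (blast intro: hstep.arg rtranclp_reduces_appL)
    next
      case delta
      \<comment> \<open>Applying both abstractions to \<open>P\<close> leads to the third
        alternative, with \<open>App s P\<close> as \<open>s'\<close> and \<open>P\<close> as
        \<open>B\<close>; instantiating \<open>rename Suc N\<close> gives back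
        \<open>N\<close>.\<close>
      have "hstep (inst t0 P) (inst s0 P) N"
        using hstep_subst[OF delta(3), of "case_nat P Var"] by simp
      then show ?thesis unfolding appL delta by (blast intro: hstep.hd)
    next
      case commute
      then show ?thesis unfolding appL by (blast intro: hstep.arg rtranclp_reduces_appL)
    next
      case inner
      then show ?thesis unfolding appL by (blast intro: hstep.arg rtranclp_reduces_appL)
    qed
  next
    case (appR P')
    with arg.hyps show ?thesis by (blast intro: hstep.arg reduces.appR)
  qed
qed

text \<open>An \<open>assoc\<close> step on an argument of the head variable can create a head
  redex, but contracting it restores a neutral term.\<close>

lemma neutral_perm:
  "neutral t \<Longrightarrow> reduces perm_rule t t' \<Longrightarrow> neutral t' \<or> (\<exists>s B. hstep t' s B \<and> neutral s)"
proof (induction arbitrary: t' rule: neutral.induct)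
  case (1 i)
  then show ?case by (auto elim: reduces_VarE)
next
  case (2 t P)
  from 2(3) show ?case
  proof (cases rule: reduces_AppE)
    case root
    then show ?thesis
    proof (cases rule: perm_rule_AppE)
      case (assoc A B)
      have "hstep t' (App t (inst A B)) B" unfolding assoc by (rule hstep_assoc)
      then show ?thesis using 2(1) by (blast intro: neutral.intros)
    qed (use 2(1) in auto)
  next
    case (appL t'')
    with 2 show ?thesis by (meson hstep.arg neutral.intros(2))
  next
    case (appR P')
    with 2 show ?thesis by (meson neutral.intros(2))
  qed
qed

text \<open>The induction is the one used for beta. In each alternative of the diagram the charges
  are only redistributed, so their sum stays within \<open>k\<close>.\<close>

lemma bounded_perm: "bounded t k \<Longrightarrow> reduces perm_rule t t' \<Longrightarrow> bounded t' k"
proof (induction "(k, t)" arbitrary: k t t'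
    rule: wf_induct_rule[OF wf_lex_prod[OF wf_less_than wf_measure[of size]]])
  case (1 k t)
  have IH: "bounded u' j"
    if "j < k \<or> j = k \<and> size u < size t" "bounded u j" "reduces perm_rule u u'" for j u u'
    using 1(1)[of j u u'] that by auto
  from 1(2) show ?case
  proof cases
    case (Var i)
    with 1(3) show ?thesis by (auto elim: reduces_VarE)
  next
    case (Lam M)
    with 1(3) obtain M' where M': "t' = Lam M'" "reduces perm_rule M M'"
      by (auto elim: reduces_LamE)
    with IH[of k M M'] Lam show ?thesis by (auto intro: bounded.Lam)
  next
    case (App t0 n P m)
    from 1(3)[unfolded App(1)] show ?thesis
    proof (cases rule: reduces_AppE)
      case root
      then show ?thesis
      proof (cases rule: perm_rule_AppE)
        case (assoc A B)
        \<comment> \<open>The contraction with argument \<open>B\<close>, charged inside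
          \<open>P\<close> before, is now charged at the head:
          \<open>n + a + b < n + m\<close>.\<close>
        have head: "hstep t' (App t0 (inst A B)) B" unfolding assoc by (rule hstep_assoc)
        have "hstep P (inst A B) B" unfolding assoc by (rule hstep.hd)
        then obtain a b where ab: "bounded (inst A B) a" "bounded B b" "a + b < m"
          using bounded_hstepE[OF App(4)] by metis
        have "bounded (App t0 (inst A B)) (n + a)"
          using App ab by (auto intro: bounded.App)
        then show ?thesis
          using bounded.hstep[OF head _ ab(2), of "n + a" k] ab App(5) by simp
      qed (use App(2) in auto)
    next
      case (appL t1)
      have t1: "bounded t1 n" using IH[of n t0 t1] App appL(2) by force
      from neutral_perm[OF App(2) appL(2)] show ?thesis
      proof (elim disjE exE conjE)
        assume "neutral t1"
        then show ?thesis using t1 App appL by (auto intro: bounded.App)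
      next
        fix s B assume s: "hstep t1 s B" "neutral s"
        obtain a b where ab: "bounded s a" "bounded B b" "a + b < n"
          using bounded_hstepE[OF t1 s(1)] by metis
        have "bounded (App s P) (a + m)" using ab s App by (auto intro: bounded.App)
        then show ?thesis
          using bounded.hstep[OF hstep.arg[OF s(1)] _ ab(2), of P "a + m" k] ab App(5) appL
          by simp
      qed
    next
      case (appR P')
      have "bounded P' m" using IH[of m P P'] App appR(2) by force
      with App appR show ?thesis by (auto intro: bounded.App)
    qed
  next
    case (hstep s N n m)
    have weak: "bounded u' j" if "(reduces perm_rule)\<^sup>*\<^sup>* u u'" "bounded u j" "j < k" for u u' j
      using that IH by (intro bounded_rtranclp[OF that(1,2)]) blast
    from hstep_perm_diagram[OF hstep(1) 1(3)]
    consider (same) s' N' where "hstep t' s' N'" "(reduces perm_rule)\<^sup>*\<^sup>* s s'"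
        "(reduces perm_rule)\<^sup>*\<^sup>* N N'"
      | (delta) s0 t0 where "s = Lam s0" "t' = Lam t0" "hstep t0 s0 (rename Suc N)"
      | (commute) u v s' B where "hstep t' u B" "hstep u v N" "(reduces perm_rule)\<^sup>*\<^sup>* s s'"
        "hstep s' v B"
      | (inner) u v B C where "hstep N C B" "(reduces beta_rule)\<^sup>*\<^sup>* s v" "hstep t' u B" "hstep u v C"
      by blast
    then show ?thesis
    proof cases
      case same
      then show ?thesis using weak[OF same(2)] weak[OF same(3)] hstep
        by (intro bounded.hstep[OF same(1), of n m]) auto
    next
      case delta
      \<comment> \<open>The head redex moves below an abstraction, which costs nothing.\<close>
      have "bounded s0 n" using hstep(2) bounded_LamD delta(1) by blast
      then have "bounded t0 k"
        using bounded.hstep[OF delta(3)] bounded_rename[OF hstep(3)] hstep(4) by blast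
      then show ?thesis unfolding delta by (rule bounded.Lam)
    next
      case commute
      have "bounded s' n" using weak[OF commute(3) hstep(2)] hstep(4) by simp
      then obtain a b where ab: "bounded v a" "bounded B b" "a + b < n"
        using bounded_hstepE[OF _ commute(4)] by metis
      \<comment> \<open>Exchanging the two contractions is affordable:
        \<open>Suc (a + m) + b\<close> is at most \<open>n + m\<close>, since
        \<open>a + b < n\<close>.\<close>
      have "bounded u (Suc (a + m))"
        using bounded.hstep[OF commute(2) ab(1) hstep(3)] by simp
      from bounded.hstep[OF commute(1) this ab(2)] show ?thesis using ab(3) hstep(4) by simp
    next
      case inner
      \<comment> \<open>The head reduct is followed by beta steps here, so this case rests on the
        result for beta. The charge \<open>m\<close> of \<open>N\<close> splits into those of
        \<open>C\<close> and \<open>B\<close> and one unit.\<close>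
      have v: "bounded v n" using bounded_rtranclp_beta[OF inner(2) hstep(2)] .
      obtain a b where ab: "bounded C a" "bounded B b" "a + b < m"
        using bounded_hstepE[OF hstep(3) inner(1)] by metis
      have "bounded u (Suc (n + a))"
        using bounded.hstep[OF inner(4) v ab(1)] by simp
      from bounded.hstep[OF inner(3) this ab(2)] show ?thesis using ab(3) hstep(4) by simp
    qed
  qed
qed

section \<open>Termination of the permutation rules\<close>

text \<open>Each rule moves an abstraction out of a product. The value 2 of variables keeps all
  values at least 2, which gives \<open>(m + 2) * n > (m + 1) * n + 1\<close> for
  \<open>delta\<close>, \<open>(m + 1) * n * p > (m * p + 1) * n\<close> for \<open>gamma\<close>
  and \<open>m * (n + 1) * p > (m * n + 1) * p\<close> for \<open>assoc\<close>.\<close>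

primrec perm_size :: "lterm \<Rightarrow> nat" where
  "perm_size (Var i) = 2"
| "perm_size (Lam M) = Suc (perm_size M)"
| "perm_size (App M N) = perm_size M * perm_size N"

lemma perm_size_ge_2: "2 \<le> perm_size t"
proof (induction t)
  case (App M N)
  then have "2 * 2 \<le> perm_size M * perm_size N" by (intro mult_le_mono)
  then show ?case by simp
qed simp_all

lemma perm_size_rename [simp]: "perm_size (rename f t) = perm_size t"
  by (induction t arbitrary: f) simp_all

lemma perm_size_root: "perm_rule M N \<Longrightarrow> perm_size N < perm_size M"
proof -
  assume "perm_rule M N"
  then obtain t P where M: "M = App t P" by (cases M) auto
  have pos: "x < x * perm_size y" if "x > 0" for x y
    using perm_size_ge_2[of y] that by simp
  have pos0: "0 < perm_size y" for y using perm_size_ge_2[of y] by simp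
  from \<open>perm_rule M N\<close>[unfolded M] show ?thesis
  proof (cases rule: perm_rule_AppE)
    case (delta A)
    then show ?thesis using perm_size_ge_2[of P] by (simp add: M)
  next
    case (gamma A B)
    then show ?thesis using pos[of "perm_size B" P] pos0 by (simp add: M algebra_simps)
  next
    case (assoc A B)
    then show ?thesis using pos[of "perm_size B" t] pos0 by (simp add: M algebra_simps)
  qed
qed

lemma perm_size_less: "reduces perm_rule M N \<Longrightarrow> perm_size N < perm_size M"
proof (induction rule: reduces.induct)
  case (appL M N P)
  then show ?case using perm_size_ge_2[of P] by simp
next
  case (appR M N P)
  then show ?case using perm_size_ge_2[of P] by simp
qed (auto intro: perm_size_root)

section \<open>Finiteness of the weight of strongly normalizing terms\<close>

lemma strongly_normalizing_step:
  assumes "strongly_normalizing R t" "reduces R t t'"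
  shows "strongly_normalizing R t'"
  unfolding strongly_normalizing_def
proof
  assume "\<exists>s. s 0 = t' \<and> (\<forall>i. reduces R (s i) (s (Suc i)))"
  then obtain s where "s 0 = t'" "\<forall>i. reduces R (s i) (s (Suc i))" by blast
  with assms(2) have "reduces R (case_nat t s i) (case_nat t s (Suc i))" for i
    by (cases i) auto
  moreover have "case_nat t s 0 = t" by simp
  ultimately show False using assms(1) unfolding strongly_normalizing_def by blast
qed

lemma wf_strongly_normalizing: "wf {(t', t). strongly_normalizing R t \<and> reduces R t t'}"
  unfolding wf_iff_no_infinite_down_chain strongly_normalizing_def by blast

inductive subterm :: "lterm \<Rightarrow> lterm \<Rightarrow> bool" for t where
  refl: "subterm t t"
| lam: "subterm t (Lam M) \<Longrightarrow> subterm t M"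
| appL: "subterm t (App M N) \<Longrightarrow> subterm t M"
| appR: "subterm t (App M N) \<Longrightarrow> subterm t N"

text \<open>The step is performed at the position of \<open>s\<close> in \<open>t\<close>, so a step
  in a subterm is progress for an induction along the reductions of the whole term.\<close>

lemma reduces_subterm:
  "subterm t s \<Longrightarrow> reduces R s s' \<Longrightarrow> \<exists>t'. reduces R t t' \<and> subterm t' s'"
proof (induction arbitrary: s' rule: subterm.induct)
  case refl
  then show ?case by (blast intro: subterm.refl)
qed (meson reduces.intros subterm.intros)+

lemma hstep_arg_subterm: "hstep t s N \<Longrightarrow> subterm r t \<Longrightarrow> subterm r N \<and> size N < size t"
proof (induction rule: hstep.induct)
  case (hd M N)
  then show ?case by (simp add: subterm.appR)
next
  case (arg t s N P)
  from arg.IH[OF subterm.appL[OF arg.prems]] show ?case by simp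
qed

text \<open>The claim is generalized to all subterms \<open>s\<close> of \<open>t\<close>. An outer
  induction along beta steps of \<open>t\<close> covers the head reduct of \<open>s\<close>; an
  inner one on the size of \<open>s\<close> covers its immediate subterms and the contracted
  argument.\<close>

lemma strongly_normalizing_bounded:
  assumes "strongly_normalizing beta_rule t"
  shows "\<exists>n. bounded t n"
proof -
  have "subterm t s \<Longrightarrow> \<exists>n. bounded s n" for s
    using assms
  proof (induction t arbitrary: s rule: wf_induct_rule[OF wf_strongly_normalizing[of beta_rule]])
    case outer: (1 t)
    from outer.prems(1) show ?case
    proof (induction s rule: measure_induct_rule[of size])
      case (less s)
      show ?case
      proof (cases s rule: head_cases)
        case (1 M)
        have "subterm t M" using less.prems unfolding 1 by (rule subterm.lam)
        then obtain n where "bounded M n" using less.IH[of M] 1 by auto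
        then show ?thesis unfolding 1 by (blast intro: bounded.Lam)
      next
        case 2
        then show ?thesis
        proof cases
          case (1 i)
          then show ?thesis by (blast intro: bounded.Var)
        next
          case (2 u P)
          have "subterm t u" "subterm t P"
            using less.prems subterm.appL subterm.appR unfolding 2 by blast+
          then obtain n m where "bounded u n" "bounded P m"
            using less.IH[of u] less.IH[of P] 2(1) by auto
          then show ?thesis unfolding 2(1) using bounded.App[OF 2(2)] by blast
        qed
      next
        case (3 s' N)
        obtain m where m: "bounded N m"
          using hstep_arg_subterm[OF 3 less.prems] less.IH by blast
        obtain t' where t': "reduces beta_rule t t'" "subterm t' s'"
          using reduces_subterm[OF less.prems hstep_beta[OF 3]] by blast
        have "strongly_normalizing beta_rule t'"
          using strongly_normalizing_step[OF outer.prems(2) t'(1)] .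
        then obtain n where n: "bounded s' n"
          using outer.IH[of t' s'] outer.prems(2) t' by auto
        have "bounded s (Suc (n + m))" by (rule bounded.hstep[OF 3 n m]) simp
        then show ?thesis by blast
      qed
    qed
  qed
  then show ?thesis using subterm.refl by blast
qed

section \<open>Lexicographic descent along a reduction sequence\<close>

lemma reduces_disj:
  "reduces (\<lambda>M N. P M N \<or> Q M N) t t' \<Longrightarrow> reduces P t t' \<or> reduces Q t t'"
  by (induction rule: reduces.induct) (auto intro: reduces.intros)

theorem theorem3p1:
  fixes t :: lterm
  assumes "strongly_normalizing beta_rule t"
  shows "strongly_normalizing
    (\<lambda>M N. beta_rule M N \<or> delta_rule M N \<or> gamma_rule M N \<or> assoc_rule M N) t"
  unfolding strongly_normalizing_def
proof
  let ?R = "\<lambda>M N. beta_rule M N \<or> delta_rule M N \<or> gamma_rule M N \<or> assoc_rule M N"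
  assume "\<exists>s. s 0 = t \<and> (\<forall>i. reduces ?R (s i) (s (Suc i)))"
  then obtain s where s: "s 0 = t" "\<And>i. reduces ?R (s i) (s (Suc i))" by blast
  have step: "reduces beta_rule (s i) (s (Suc i)) \<or> reduces perm_rule (s i) (s (Suc i))" for i
    using s(2)[of i] by (intro reduces_disj) (simp add: perm_rule_def)
  have ex: "\<exists>n. bounded (s i) n" for i
  proof (induction i)
    case 0
    then show ?case using strongly_normalizing_bounded[OF assms] s(1) by simp
  next
    case (Suc i)
    then show ?case using step[of i] bounded_beta bounded_perm by blast
  qed
  define w where "w i = (LEAST n. bounded (s i) n)" for i
  have w: "bounded (s i) (w i)" for i unfolding w_def using ex by (rule LeastI_ex)
  have le: "w i \<le> n" if "bounded (s i) n" for i n unfolding w_def using that by (rule Least_le)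
  \<comment> \<open>Beta steps lower the first component; permutation steps do not raise it and
    lower the second.\<close>
  define f where "f i = (w i, perm_size (s i))" for i
  have "(f (Suc i), f i) \<in> less_than <*lex*> less_than" for i
    using step[of i]
  proof
    assume "reduces beta_rule (s i) (s (Suc i))"
    then show ?thesis unfolding f_def using bounded_beta[OF w] le[of "Suc i"] by fastforce
  next
    assume "reduces perm_rule (s i) (s (Suc i))"
    then show ?thesis unfolding f_def using le[OF bounded_perm[OF w]] perm_size_less by fastforce
  qed
  moreover have "wf (less_than <*lex*> less_than)" by auto
  ultimately show False unfolding wf_iff_no_infinite_down_chain by blast
qed

end
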